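(* Let $f(x)\in\mathbb{Q}[x]$ be any polynomial. Then the following two conditions are equivalent: (1) every irrational root of $f$ (i.e. every root of $f$ in $\mathbb{C}$ that is not in $\mathbb{Q}$) is real and is a simple root of $f$; (2) there exists a polynomial $F(x)\in\mathbb{Q}[x]$ such that all roots of $F(x)$ are rational and $f(x)$ divides the derivative $F'(x)$.
   Formalization: In condition (2) the polynomial F is required to be nonconstant; otherwise F = 1 (no roots, zero derivative) would satisfy (2) for every f, and the equivalence would fail for example for f = x^2 + 1. *)

theory Defs
  imports Complex_Main "HOL-Computational_Algebra.Computational_Algebra"
begin

abbreviation complex_poly :: "rat poly \<Rightarrow> complex poly" where
  "complex_poly p \<equiv> map_poly of_rat p"

definition irrational_roots_real_simple :: "rat poly \<Rightarrow> bool" where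
  "irrational_roots_real_simple f \<longleftrightarrow>
     (\<forall>z. poly (complex_poly f) z = 0 \<and> z \<notin> \<rat> \<longrightarrow>
        z \<in> \<real> \<and> order z (complex_poly f) = 1)"

definition all_roots_rational :: "rat poly \<Rightarrow> bool" where
  "all_roots_rational F \<longleftrightarrow> (\<forall>z. poly (complex_poly F) z = 0 \<longrightarrow> z \<in> \<rat>)"

end

theory Submission
  imports Defs
begin

text \<open>
  For \<open>(2) \<Longrightarrow> (1)\<close>, at a point \<open>z\<close> with \<open>F z \<noteq> 0\<close> the logarithmic derivative of \<open>F\<close> is
  \<open>\<Sum> 1 / (z - r)\<close> over the (rational) roots \<open>r\<close> of \<open>F\<close>: its imaginary part does not vanish for
  non-real \<open>z\<close>, and its derivative \<open>- \<Sum> 1 / (z - r)\<^sup>2\<close> does not vanish for real \<open>z\<close>.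

  For \<open>(1) \<Longrightarrow> (2)\<close>, write \<open>f = h g\<close> with \<open>h\<close> split over the rationals and \<open>g\<close> without rational roots.
  Interlace the \<open>n\<close> roots of \<open>g\<close> with rationals \<open>r\<^sub>0 < \<dots> < r\<^sub>n\<close>. In the partial fraction expansion
  \<open>g / \<Prod> (x - r\<^sub>i) = \<Sum> m\<^sub>i / (x - r\<^sub>i)\<close> all \<open>m\<^sub>i\<close> are rational and, for monic \<open>g\<close>, positive, so after
  clearing denominators it is the logarithmic derivative of some \<open>\<Prod> (x - r\<^sub>i) ^ N\<^sub>i\<close>, whose
  derivative is thus divisible by \<open>g\<close>. One of the \<open>r\<^sub>i\<close> may be prescribed; multiplying the squares
  of the polynomials obtained for the roots of \<open>h\<close> yields \<open>F\<close>.
\<close>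

subsection \<open>Rational polynomials as complex polynomials\<close>

lemma of_real_of_rat: "of_real (of_rat q) = (of_rat q :: 'a :: real_field)"
  by (cases q) (simp add: of_rat_rat)

lemma Rats_imp_Reals: "z \<in> \<rat> \<Longrightarrow> z \<in> (\<real> :: 'a :: real_field set)"
  by (metis Rats_cases Reals_of_real of_real_of_rat)

lemma map_poly_of_rat_mult:
  "map_poly of_rat (p * q) = (map_poly of_rat p * map_poly of_rat q :: 'a :: field_char_0 poly)"
  by (intro poly_eqI) (simp add: coeff_map_poly coeff_mult of_rat_sum of_rat_mult)

lemma map_poly_of_rat_pderiv:
  "map_poly of_rat (pderiv p) = pderiv (map_poly of_rat p :: 'a :: field_char_0 poly)"
  by (intro poly_eqI) (simp add: coeff_map_poly coeff_pderiv of_rat_mult of_rat_add)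

lemma map_poly_of_rat_eq_0_iff [simp]:
  "map_poly of_rat p = (0 :: 'a :: field_char_0 poly) \<longleftrightarrow> p = 0"
  by (intro map_poly_eq_0_iff) auto

lemma poly_map_poly_of_rat:
  "poly (map_poly of_rat p) (of_rat x) = (of_rat (poly p x) :: 'a :: field_char_0)"
  by (induction p) (simp_all add: map_poly_pCons of_rat_add of_rat_mult)

lemma all_roots_rational_mult:
  "all_roots_rational F \<Longrightarrow> all_roots_rational G \<Longrightarrow> all_roots_rational (F * G)"
  by (auto simp: all_roots_rational_def map_poly_of_rat_mult)

lemma all_roots_rational_linear: "all_roots_rational [:- r, 1:]"
  by (auto simp: all_roots_rational_def map_poly_pCons of_rat_minus add_eq_0_iff2 Rats_minus_iff)

lemma all_roots_rational_power:
  "all_roots_rational F \<Longrightarrow> all_roots_rational (F ^ n)"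
  by (induction n) (auto intro: all_roots_rational_mult simp: all_roots_rational_def[of 1])

lemma all_roots_rational_prod:
  "(\<And>i. i \<in> S \<Longrightarrow> all_roots_rational (F i)) \<Longrightarrow> all_roots_rational (prod F S)"
  by (induction S rule: infinite_finite_induct)
     (auto intro: all_roots_rational_mult simp: all_roots_rational_def[of 1])

subsection \<open>Critical points of real-rooted polynomials\<close>

text \<open>For real \<open>r\<close> the imaginary part of \<open>1 / (z - r)\<close> has sign
  opposite to \<open>Im z\<close>, so the summands of the logarithmic derivative cannot cancel. The
  factor \<open>Im z\<close> treats both half planes at once.\<close>

lemma Im_logderiv:
  fixes A :: "complex multiset"
  assumes "set_mset A \<subseteq> \<real>" "Im z \<noteq> 0"
  defines "P \<equiv> \<Prod>x\<in>#A. [:- x, 1:]"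
  shows "poly P z \<noteq> 0 \<and> (A \<noteq> {#} \<longrightarrow> Im (poly (pderiv P) z / poly P z) * Im z < 0)"
  using assms(1) unfolding P_def
proof (induction A)
  case empty
  then show ?case by simp
next
  case (add r A)
  define Q where "Q = (\<Prod>x\<in>#A. [:- x, 1:])"
  have r: "Im r = 0" and nz: "z - r \<noteq> 0"
    using add.prems assms(2) by (auto simp: complex_is_Real_iff)
  have Q: "poly Q z \<noteq> 0"
    using add by (simp add: Q_def)
  have eq: "(\<Prod>x\<in>#add_mset r A. [:- x, 1:]) = [:- r, 1:] * Q"
    by (simp add: Q_def)
  have "poly (pderiv ([:- r, 1:] * Q)) z / poly ([:- r, 1:] * Q) z
      = 1 / (z - r) + poly (pderiv Q) z / poly Q z"
    using Q nz by (simp add: pderiv_mult pderiv_pCons field_simps del: mult_pCons_left mult_pCons_right)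
  moreover have "Im (1 / (z - r)) * Im z < 0"
  proof -
    have "Im (1 / (z - r)) * Im z = - (Im z)\<^sup>2 / ((Re (z - r))\<^sup>2 + (Im z)\<^sup>2)"
      using r by (simp add: Im_divide power2_eq_square)
    also have "\<dots> < 0"
      using assms(2) by (intro divide_neg_pos) (auto intro: add_nonneg_pos)
    finally show ?thesis .
  qed
  moreover have "Im (poly (pderiv Q) z / poly Q z) * Im z \<le> 0"
    using add by (cases "A = {#}") (auto simp: Q_def intro: less_imp_le)
  ultimately show ?case
    using Q nz unfolding eq by (simp add: distrib_right)
qed

text \<open>The left side of the identity is \<open>- P\<^sup>2\<close> times the derivative of
  \<open>P' / P\<close>, written without division; thus \<open>d\<close> is the sum of
  \<open>1 / (z - r)\<^sup>2\<close>, and each new root \<open>r\<close> contributes one such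
  positive term.\<close>

lemma deriv_logderiv:
  fixes A :: "complex multiset"
  assumes "set_mset A \<subseteq> \<real>" "z \<in> \<real>" "z \<notin># A"
  defines "P \<equiv> \<Prod>x\<in>#A. [:- x, 1:]"
  shows "poly P z \<noteq> 0 \<and> (\<exists>d\<ge>0. (A \<noteq> {#} \<longrightarrow> d > 0) \<and>
    (poly (pderiv P) z)\<^sup>2 - poly (pderiv (pderiv P)) z * poly P z = of_real d * (poly P z)\<^sup>2)"
  using assms(1,3) unfolding P_def
proof (induction A)
  case empty
  then show ?case by auto
next
  case (add r A)
  define Q where "Q = (\<Prod>x\<in>#A. [:- x, 1:])"
  obtain t where t: "z - r = of_real t"
    using add.prems assms(2) by (metis Reals_cases Reals_diff insert_subset set_mset_add_mset_insert)
  have nz: "t \<noteq> 0" "z - r \<noteq> 0"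
    using add.prems t by auto
  obtain d where d: "d \<ge> 0" and Q: "poly Q z \<noteq> 0" and
    eq: "(poly (pderiv Q) z)\<^sup>2 - poly (pderiv (pderiv Q)) z * poly Q z = of_real d * (poly Q z)\<^sup>2"
    using add by (auto simp: Q_def)
  have eq2: "(\<Prod>x\<in>#add_mset r A. [:- x, 1:]) = [:- r, 1:] * Q"
    by (simp add: Q_def)
  have P: "poly ([:- r, 1:] * Q) z = (z - r) * poly Q z"
    "poly (pderiv ([:- r, 1:] * Q)) z = (z - r) * poly (pderiv Q) z + poly Q z"
    "poly (pderiv (pderiv ([:- r, 1:] * Q))) z
       = (z - r) * poly (pderiv (pderiv Q)) z + 2 * poly (pderiv Q) z"
    by (simp_all add: pderiv_mult pderiv_pCons pderiv_add algebra_simps del: mult_pCons_left mult_pCons_right)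
  have "((z - r) * poly (pderiv Q) z + poly Q z)\<^sup>2
        - ((z - r) * poly (pderiv (pderiv Q)) z + 2 * poly (pderiv Q) z) * ((z - r) * poly Q z)
      = (z - r)\<^sup>2 * ((poly (pderiv Q) z)\<^sup>2 - poly (pderiv (pderiv Q)) z * poly Q z) + (poly Q z)\<^sup>2"
    by (simp add: power2_eq_square algebra_simps)
  also have "\<dots> = of_real (d + 1 / t\<^sup>2) * ((z - r) * poly Q z)\<^sup>2"
    unfolding eq t using nz by (simp add: field_simps)
  finally have *: "((z - r) * poly (pderiv Q) z + poly Q z)\<^sup>2
        - ((z - r) * poly (pderiv (pderiv Q)) z + 2 * poly (pderiv Q) z) * ((z - r) * poly Q z)
      = of_real (d + 1 / t\<^sup>2) * ((z - r) * poly Q z)\<^sup>2" .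
  have "d + 1 / t\<^sup>2 > 0"
    using d nz by (intro add_nonneg_pos) auto
  then show ?case
    unfolding eq2 P using * Q nz by (intro conjI exI[of _ "d + 1 / t\<^sup>2"]) auto
qed

lemma critical_points_real_simple:
  fixes P :: "complex poly"
  assumes deg: "degree P > 0" and roots: "\<And>z. poly P z = 0 \<Longrightarrow> z \<in> \<real>"
    and z: "poly (pderiv P) z = 0" "poly P z \<noteq> 0"
  shows "z \<in> \<real> \<and> order z (pderiv P) = 1"
proof -
  have P0: "P \<noteq> 0" using deg by auto
  define Q where "Q = (\<Prod>x\<in>#proots P. [:- x, 1:])"
  have PQ: "P = smult (lead_coeff P) Q"
    unfolding Q_def by (rule complex_poly_decompose_multiset [symmetric])
  have A: "set_mset (proots P) \<subseteq> \<real>" "z \<notin># proots P"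
    using roots z P0 by auto
  have ne: "proots P \<noteq> {#}"
  proof
    assume "proots P = {#}"
    hence "P = [:lead_coeff P:]" using PQ by (simp add: Q_def)
    thus False using deg by (metis degree_pCons_0 less_irrefl)
  qed
  have dQ: "poly (pderiv Q) z = 0"
    using z P0 by (subst (asm) PQ) (simp add: pderiv_smult)
  have "z \<in> \<real>"
    using Im_logderiv[OF A(1), of z] ne dQ by (auto simp: Q_def complex_is_Real_iff)
  \<comment> \<open>As \<open>Q' z = 0\<close>, the identity reads
    \<open>- Q'' z * Q z = d * (Q z)\<^sup>2\<close> with \<open>d > 0\<close>.\<close>
  moreover have "poly (pderiv (pderiv Q)) z \<noteq> 0"
    using deriv_logderiv[OF A(1) \<open>z \<in> \<real>\<close> A(2)] ne dQ by (auto simp: Q_def)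
  hence "poly (pderiv (pderiv P)) z \<noteq> 0"
    using P0 by (subst PQ) (simp add: pderiv_smult)
  hence "order z (pderiv P) = 1"
    using z by (metis One_nat_def order_0I order_pderiv pderiv_0 poly_0)
  ultimately show ?thesis by blast
qed

text \<open>An irrational root of \<open>f\<close> is a critical point of \<open>F\<close> but not a
  root of \<open>F\<close>, and its order in \<open>f\<close> is at most its order in
  \<open>F'\<close>.\<close>

lemma irrational_roots_real_simple_if_dvd_pderiv:
  assumes "degree F > 0" "all_roots_rational F" "f dvd pderiv F"
  shows "irrational_roots_real_simple f"
  unfolding irrational_roots_real_simple_def
proof (intro allI impI)
  fix z assume z: "poly (complex_poly f) z = 0 \<and> z \<notin> \<rat>"
  obtain k where "pderiv F = f * k" using assms(3) by auto
  hence k: "pderiv (complex_poly F) = complex_poly f * complex_poly k"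
    by (metis map_poly_of_rat_mult map_poly_of_rat_pderiv)
  have deg: "degree (complex_poly F) > 0"
    using assms(1) by (simp add: degree_map_poly)
  have nz: "pderiv (complex_poly F) \<noteq> 0"
    using deg by (simp add: pderiv_eq_0_iff)
  have F: "poly (complex_poly F) w = 0 \<Longrightarrow> w \<in> \<rat>" for w
    using assms(2) by (simp add: all_roots_rational_def)
  have *: "z \<in> \<real> \<and> order z (pderiv (complex_poly F)) = 1"
  proof (rule critical_points_real_simple[OF deg])
    show "w \<in> \<real>" if "poly (complex_poly F) w = 0" for w
      using F[OF that] by (rule Rats_imp_Reals)
  qed (use z k F in auto)
  have "order z (complex_poly f) \<le> 1"
    using dvd_imp_order_le[OF nz, of "complex_poly f" z] k * by simp
  moreover have "order z (complex_poly f) \<noteq> 0"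
    using z nz k by (metis mult_zero_left order_root)
  ultimately show "z \<in> \<real> \<and> order z (complex_poly f) = 1"
    using * by simp
qed

subsection \<open>Interlacing\<close>

lemma interlacing_rats:
  fixes \<alpha> :: "nat \<Rightarrow> real" and \<rho> :: rat
  assumes mono: "\<And>i j. i < j \<Longrightarrow> j < n \<Longrightarrow> \<alpha> i < \<alpha> j"
    and irrat: "\<And>i. i < n \<Longrightarrow> \<alpha> i \<notin> \<rat>"
  obtains r :: "nat \<Rightarrow> rat" where "\<rho> \<in> r ` {..n}"
    "\<And>i. i < n \<Longrightarrow> of_rat (r i) < \<alpha> i" "\<And>i. i < n \<Longrightarrow> \<alpha> i < of_rat (r (Suc i))"
proof -
  \<comment> \<open>\<open>P k x\<close> places \<open>x\<close> in the \<open>k\<close>-th of the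
    \<open>n + 1\<close> open gaps cut out by the \<open>\<alpha>\<close>; the gaps \<open>0\<close>
    and \<open>n\<close> are unbounded on the outside.\<close>
  define P where "P k x \<longleftrightarrow> (k > 0 \<longrightarrow> \<alpha> (k - 1) < of_rat x) \<and> (k < n \<longrightarrow> of_rat x < \<alpha> k)" for k x
  have "\<exists>x. P k x" if "k \<le> n" for k
  proof -
    define a where "a = (if k > 0 then \<alpha> (k - 1) else \<alpha> k - 1)"
    define b where "b = (if k < n then \<alpha> k else a + 1)"
    have "a < b"
      using mono[of "k - 1" k] that by (auto simp: a_def b_def)
    then obtain x where "a < of_rat x" "of_rat x < b"
      using of_rat_dense by blast
    hence "P k x" by (auto simp: P_def a_def b_def)
    thus ?thesis ..
  qed
  then obtain r where r: "\<And>k. k \<le> n \<Longrightarrow> P k (r k)" by metis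
  \<comment> \<open>The index of the gap containing \<open>\<rho>\<close>. As the
    \<open>\<alpha>\<close> are irrational, \<open>\<rho>\<close> is never an endpoint, so it can
    replace the point chosen in that gap.\<close>
  define k where "k = (LEAST k. k = n \<or> of_rat \<rho> < \<alpha> k)"
  have k: "k = n \<or> of_rat \<rho> < \<alpha> k"
    unfolding k_def by (rule LeastI[of _ n]) simp
  have kn: "k \<le> n"
    unfolding k_def by (rule Least_le) simp
  have "\<alpha> (k - 1) < of_rat \<rho>" if "k > 0"
  proof -
    have "\<not> (k - 1 = n \<or> of_rat \<rho> < \<alpha> (k - 1))"
      using that not_less_Least[of "k - 1" "\<lambda>k. k = n \<or> of_rat \<rho> < \<alpha> k"]
      by (auto simp: k_def[symmetric])
    moreover have "\<alpha> (k - 1) \<notin> \<rat>"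
      using that kn by (intro irrat) linarith
    hence "\<alpha> (k - 1) \<noteq> of_rat \<rho>" by auto
    ultimately show ?thesis by auto
  qed
  hence "P k \<rho>" using k by (auto simp: P_def)
  with r have r': "P i ((r(k := \<rho>)) i)" if "i \<le> n" for i
    using that by simp
  show ?thesis
  proof
    show "\<rho> \<in> (r(k := \<rho>)) ` {..n}" using kn by (auto simp: image_iff)
    show "of_rat ((r(k := \<rho>)) i) < \<alpha> i" if "i < n" for i
      using r'[of i] that by (simp add: P_def del: fun_upd_apply)
    show "\<alpha> i < of_rat ((r(k := \<rho>)) (Suc i))" if "i < n" for i
      using r'[of "Suc i"] that by (simp add: P_def del: fun_upd_apply)
  qed
qed

lemma interlacing_less:
  fixes \<alpha> x :: "nat \<Rightarrow> real"
  assumes "\<And>i. i < n \<Longrightarrow> x i < \<alpha> i" "\<And>i. i < n \<Longrightarrow> \<alpha> i < x (Suc i)"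
  assumes "k < i" "i \<le> n"
  shows "\<alpha> k < x i" "x k < \<alpha> (i - 1)"
proof -
  have "\<alpha> k < x i \<and> x k < \<alpha> (i - 1)"
    using assms(3,4)
  proof (induction i)
    case (Suc i)
    show ?case
    proof (cases "k = i")
      case True
      then show ?thesis using Suc.prems assms(1)[of i] assms(2)[of i] by auto
    next
      case False
      hence "\<alpha> k < x i" "x k < \<alpha> (i - 1)" using Suc by auto
      moreover have "x i < \<alpha> i" "\<alpha> i < x (Suc i)" "\<alpha> (i - 1) < x i"
        using Suc.prems False assms(1)[of i] assms(2)[of i] assms(2)[of "i - 1"] by auto
      ultimately show ?thesis by auto
    qed
  qed simp
  thus "\<alpha> k < x i" "x k < \<alpha> (i - 1)" by auto
qed

text \<open>This quotient is the coefficient at \<open>x i\<close> in the partial fraction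
  expansion. Pairing each \<open>\<alpha> k\<close> with a node on the same side of
  \<open>x i\<close> makes every factor positive.\<close>

lemma interlacing_weight_pos:
  fixes \<alpha> x :: "nat \<Rightarrow> real"
  assumes "\<And>i. i < n \<Longrightarrow> x i < \<alpha> i" "\<And>i. i < n \<Longrightarrow> \<alpha> i < x (Suc i)" and i: "i \<le> n"
  shows "(\<Prod>k<n. x i - \<alpha> k) / (\<Prod>k\<in>{..n} - {i}. x i - x k) > 0"
proof -
  \<comment> \<open>\<open>x (h k)\<close> is the neighbour of \<open>\<alpha> k\<close> that lies
    farther from \<open>x i\<close>.\<close>
  define h where "h k = (if k < i then k else Suc k)" for k
  have less: "\<alpha> k < x j" "x k < \<alpha> (j - 1)" if "k < j" "j \<le> n" for k j
    using interlacing_less[of n x \<alpha> k j] assms that by auto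
  have "{..n} - {i} = h ` {..<n}"
  proof (intro equalityI subsetI)
    fix k assume "k \<in> {..n} - {i}"
    hence "k = h (if k < i then k else k - 1)" "(if k < i then k else k - 1) < n"
      using i by (auto simp: h_def)
    thus "k \<in> h ` {..<n}" by blast
  qed (use i in \<open>auto simp: h_def split: if_splits\<close>)
  moreover have "inj_on h {..<n}" by (auto simp: inj_on_def h_def split: if_splits)
  ultimately have "(\<Prod>k\<in>{..n} - {i}. x i - x k) = (\<Prod>k<n. x i - x (h k))"
    by (simp add: prod.reindex)
  hence "(\<Prod>k<n. x i - \<alpha> k) / (\<Prod>k\<in>{..n} - {i}. x i - x k)
      = (\<Prod>k<n. (x i - \<alpha> k) / (x i - x (h k)))"
    by (simp add: prod_dividef)
  also have "\<dots> > 0"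
  proof (rule prod_pos)
    fix k assume k: "k \<in> {..<n}"
    show "(x i - \<alpha> k) / (x i - x (h k)) > 0"
    proof (cases "k < i")
      case True
      thus ?thesis using less(1)[OF True i] assms(1)[of k] k by (simp add: h_def)
    next
      case False
      thus ?thesis using less(2)[of i "Suc k"] assms(2)[of k] k
        by (simp add: h_def zero_less_divide_iff)
    qed
  qed
  finally show ?thesis .
qed

subsection \<open>Polynomials with prescribed critical points\<close>

text \<open>Turns positive rational weights into exponents with the same ratios.\<close>

lemma clear_denominators_pos:
  fixes w :: "'a \<Rightarrow> rat"
  assumes "finite S" "\<And>i. i \<in> S \<Longrightarrow> w i > 0"
  shows "\<exists>c N. c > 0 \<and> (\<forall>i\<in>S. N i > 0 \<and> of_nat (N i) = of_nat c * w i)"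
  using assms
proof (induction S)
  case empty
  show ?case by (intro exI[of _ 1]) auto
next
  case (insert s S)
  then obtain c N where cN: "c > 0" "\<And>i. i \<in> S \<Longrightarrow> N i > 0 \<and> of_nat (N i) = of_nat c * w i"
    by (metis insert_iff)
  obtain a b :: int where ab: "b > 0" "w s = of_int a / of_int b"
    by (metis Fract_of_int_quotient Rat_cases)
  have a: "a > 0"
    using insert.prems[of s] ab by (simp add: zero_less_divide_iff)
  define N' where "N' = (\<lambda>i. if i = s then c * nat a else nat b * N i)"
  have "N' i > 0 \<and> of_nat (N' i) = of_nat (c * nat b) * w i" if "i \<in> insert s S" for i
  proof (cases "i = s")
    case True
    thus ?thesis using cN(1) a ab by (simp add: N'_def)
  next
    case False
    thus ?thesis using cN(2)[of i] that a ab by (simp add: N'_def)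
  qed
  moreover have "c * nat b > 0" using cN ab by simp
  ultimately show ?case by blast
qed

text \<open>The product rule with the common factors pulled out; the remaining sum is the
  logarithmic derivative times the product of the distinct linear factors.\<close>

lemma pderiv_prod_linear_powers:
  fixes r :: "'b \<Rightarrow> 'a :: idom"
  assumes "finite S" "\<And>k. k \<in> S \<Longrightarrow> N k > 0"
  shows "pderiv (\<Prod>k\<in>S. [:- r k, 1:] ^ N k) = (\<Prod>k\<in>S. [:- r k, 1:] ^ (N k - 1)) *
    (\<Sum>k\<in>S. smult (of_nat (N k)) (\<Prod>j\<in>S - {k}. [:- r j, 1:]))"
  unfolding pderiv_prod sum_distrib_left
proof (rule sum.cong)
  fix k assume k: "k \<in> S"
  have "[:- r j, 1:] ^ N j = [:- r j, 1:] ^ (N j - 1) * [:- r j, 1:]" if "j \<in> S" for j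
    using assms(2)[OF that] by (metis power_minus_mult)
  hence "(\<Prod>j\<in>S - {k}. [:- r j, 1:] ^ N j)
      = (\<Prod>j\<in>S - {k}. [:- r j, 1:] ^ (N j - 1)) * (\<Prod>j\<in>S - {k}. [:- r j, 1:])"
    unfolding prod.distrib[symmetric] by (intro prod.cong) auto
  thus "(\<Prod>j\<in>S - {k}. [:- r j, 1:] ^ N j) * pderiv ([:- r k, 1:] ^ N k) =
      (\<Prod>k\<in>S. [:- r k, 1:] ^ (N k - 1)) * smult (of_nat (N k)) (\<Prod>j\<in>S - {k}. [:- r j, 1:])"
    using k assms(1) by (simp add: pderiv_power pderiv_pCons prod.remove[of S k] mult_ac)
qed simp

text \<open>\<open>A\<close> is the set of roots of \<open>g\<close>; \<open>eval\<close> expresses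
  the factorization at rational points only, which suffices because the nodes are rational. The
  prescribed root \<open>\<rho>\<close> is what later accounts for a rational root of
  \<open>f\<close>.\<close>

lemma exists_poly_prescribed_critical_points:
  fixes g :: "rat poly" and A :: "real set"
  assumes g: "g \<noteq> 0" and A: "finite A" "card A = degree g" "A \<inter> \<rat> = {}"
    and eval: "\<And>x. of_rat (poly g x) = of_rat (lead_coeff g) * (\<Prod>a\<in>A. of_rat x - a)"
  obtains F where "degree F > 0" "all_roots_rational F" "poly F \<rho> = 0" "g dvd pderiv F"
proof -
  define n where "n = degree g"
  define \<alpha> where "\<alpha> i = sorted_list_of_set A ! i" for i
  have bij: "bij_betw \<alpha> {..<n} A"
    unfolding \<alpha>_def using A by (intro bij_betw_nth) (auto simp: n_def)
  have "\<alpha> i < \<alpha> j" if "i < j" "j < n" for i j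
    using that A by (auto simp: \<alpha>_def n_def intro!: sorted_wrt_nth_less[of "(<)"])
  moreover have "\<alpha> i \<notin> \<rat>" if "i < n" for i
    using bij that A(3) by (auto dest: bij_betwE)
  ultimately obtain r where r: "\<rho> \<in> r ` {..n}" "\<And>i. i < n \<Longrightarrow> of_rat (r i) < \<alpha> i"
    "\<And>i. i < n \<Longrightarrow> \<alpha> i < of_rat (r (Suc i))"
    using interlacing_rats[of n \<alpha> \<rho>] by blast
  have "r k < r i" if "k < i" "i \<le> n" for k i
  proof -
    have "of_rat (r k) < \<alpha> k" using r(2)[of k] that by simp
    also have "\<alpha> k < of_rat (r i)"
      using interlacing_less(1)[of n "\<lambda>i. of_rat (r i)" \<alpha> k i] r that by auto
    finally show ?thesis by (simp add: of_rat_less)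
  qed
  hence inj: "inj_on r {..n}"
    by (intro linorder_inj_onI') (metis atMost_iff less_irrefl)
  \<comment> \<open>\<open>D i\<close> is the derivative of the node polynomial at
    \<open>r i\<close>, so \<open>w i\<close> is the partial fraction coefficient of the monic
    multiple of \<open>g\<close>.\<close>
  define D where "D i = (\<Prod>k\<in>{..n} - {i}. r i - r k)" for i
  define w where "w i = poly g (r i) / (lead_coeff g * D i)" for i
  have w: "w i > 0" if "i \<in> {..n}" for i
  proof -
    have "(of_rat (w i) :: real) =
        (\<Prod>k<n. of_rat (r i) - \<alpha> k) / (\<Prod>k\<in>{..n} - {i}. of_rat (r i) - of_rat (r k))"
      using g by (simp add: w_def D_def of_rat_divide of_rat_mult eval of_rat_prod of_rat_diff
                       flip: prod.reindex_bij_betw[OF bij])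
    also have "\<dots> > 0"
      using r that by (intro interlacing_weight_pos[of n "\<lambda>i. of_rat (r i)" \<alpha> i]) auto
    finally show ?thesis by simp
  qed
  obtain c N where c: "c > 0" and
    N: "\<And>i. i \<in> {..n} \<Longrightarrow> N i > 0 \<and> of_nat (N i) = of_nat c * w i"
    using clear_denominators_pos[of "{..n}" w] w by auto
  define F where "F = (\<Prod>k\<in>{..n}. [:- r k, 1:] ^ N k)"
  define T where "T = (\<Sum>k\<in>{..n}. smult (of_nat (N k)) (\<Prod>j\<in>{..n} - {k}. [:- r j, 1:]))"
  \<comment> \<open>Both sides have degree at most \<open>n\<close> and agree at
    \<open>n + 1\<close> nodes: at \<open>r i\<close> every summand of \<open>T\<close> except the
    \<open>i\<close>-th vanishes.\<close>
  have "T = smult (of_nat c / lead_coeff g) g"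
  proof (rule poly_eqI_degree[where A = "r ` {..n}"])
    fix x assume "x \<in> r ` {..n}"
    then obtain i where i: "i \<le> n" "x = r i" by auto
    have D: "D i \<noteq> 0"
      using inj i by (auto simp: D_def inj_on_def)
    have "poly T x = (\<Sum>k\<in>{..n}. of_nat (N k) * (\<Prod>j\<in>{..n} - {k}. r i - r j))"
      by (simp add: T_def poly_sum poly_prod i)
    also have "\<dots> = (\<Sum>k\<in>{..n}. if k = i then of_nat (N i) * D i else 0)"
      using i by (intro sum.cong) (auto simp: D_def)
    also have "\<dots> = of_nat (N i) * D i"
      using i by simp
    also have "\<dots> = of_nat c / lead_coeff g * poly g x"
      using D N[of i] i by (simp add: w_def)
    finally show "poly T x = poly (smult (of_nat c / lead_coeff g) g) x" by simp
  next
    have "degree T \<le> n"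
      unfolding T_def
    proof (rule degree_sum_le)
      fix k assume "k \<in> {..n}"
      thus "degree (smult (of_nat (N k)) (\<Prod>j\<in>{..n} - {k}. [:- r j, 1:])) \<le> n"
        by (intro order.trans[OF degree_smult_le]) (simp add: degree_prod_eq_sum_degree)
    qed simp
    thus "degree T < card (r ` {..n})" using inj by (simp add: card_image)
    show "degree (smult (of_nat c / lead_coeff g) g) < card (r ` {..n})"
      using inj by (simp add: card_image n_def)
  qed
  moreover have "pderiv F = (\<Prod>k\<in>{..n}. [:- r k, 1:] ^ (N k - 1)) * T"
    unfolding F_def T_def using N by (intro pderiv_prod_linear_powers) auto
  ultimately have "g dvd pderiv F" by (simp add: dvd_smult)
  moreover have "poly F \<rho> = 0"
  proof -
    obtain i where "i \<in> {..n}" "\<rho> = r i" using r(1) by auto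
    thus ?thesis using N[of i] by (auto simp: F_def poly_prod)
  qed
  moreover have "all_roots_rational F"
    unfolding F_def
    by (intro all_roots_rational_prod all_roots_rational_power all_roots_rational_linear)
  moreover have "degree F > 0"
  proof -
    have "F \<noteq> 0" by (simp add: F_def)
    thus ?thesis using \<open>poly F \<rho> = 0\<close> by (auto elim!: degree_eq_zeroE intro!: gr0I)
  qed
  ultimately show ?thesis using that by blast
qed

subsection \<open>The rational roots\<close>

lemma split_off_roots:
  fixes f :: "'a :: field poly"
  assumes "f \<noteq> 0"
  obtains L g where "f = (\<Prod>\<rho>\<leftarrow>L. [:- \<rho>, 1:]) * g" "\<And>x. poly g x \<noteq> 0"
proof -
  have "\<exists>L g. f = (\<Prod>\<rho>\<leftarrow>L. [:- \<rho>, 1:]) * g \<and> (\<forall>x. poly g x \<noteq> 0)"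
    using assms
  proof (induction "degree f" arbitrary: f rule: less_induct)
    case less
    show ?case
    proof (cases "\<exists>x. poly f x = 0")
      case False
      thus ?thesis by (intro exI[of _ "[]"] exI[of _ f]) simp
    next
      case True
      then obtain x q where q: "f = [:- x, 1:] * q"
        by (auto simp: poly_eq_0_iff_dvd)
      with less.prems have "degree q < degree f" "q \<noteq> 0"
        by (auto simp: degree_mult_eq simp del: mult_pCons_left)
      then obtain L g where "q = (\<Prod>\<rho>\<leftarrow>L. [:- \<rho>, 1:]) * g" "\<forall>x. poly g x \<noteq> 0"
        using less.hyps by blast
      thus ?thesis
        unfolding q by (intro exI[of _ "x # L"] exI[of _ g]) (simp add: mult.assoc del: mult_pCons_left)
    qed
  qed
  thus ?thesis using that by blast
qed

lemma exists_poly_if_irrational_roots_real_simple: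
  assumes f: "irrational_roots_real_simple f"
  shows "\<exists>F. degree F > 0 \<and> all_roots_rational F \<and> f dvd pderiv F"
proof -
  \<comment> \<open>For \<open>f = 0\<close> the non-real number \<open>\<i>\<close> would be an
    irrational root.\<close>
  have f0: "f \<noteq> 0"
  proof
    assume "f = 0"
    hence "\<i> \<in> \<real>" if "\<i> \<notin> \<rat>"
      using f that by (auto simp: irrational_roots_real_simple_def)
    moreover have "\<i> \<notin> \<rat>"
      using Rats_imp_Reals[of \<i>] by (auto simp: complex_is_Real_iff)
    ultimately show False by (simp add: complex_is_Real_iff)
  qed
  obtain L g where fL: "f = (\<Prod>\<rho>\<leftarrow>L. [:- \<rho>, 1:]) * g" and g: "\<And>x. poly g x \<noteq> 0"
    using split_off_roots[OF f0] by metis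
  have g0: "g \<noteq> 0" using g by auto
  have g_dvd: "complex_poly g dvd complex_poly f"
    by (simp add: fL map_poly_of_rat_mult)
  have root: "z \<notin> \<rat> \<and> z \<in> \<real> \<and> order z (complex_poly g) = 1"
    if z: "poly (complex_poly g) z = 0" for z
  proof -
    have irr: "z \<notin> \<rat>"
      using z g by (metis Rats_cases of_rat_eq_0_iff poly_map_poly_of_rat)
    have "poly (complex_poly f) z = 0"
      using z g_dvd by auto
    with irr f have "z \<in> \<real>" "order z (complex_poly f) = 1"
      by (auto simp: irrational_roots_real_simple_def)
    moreover have "order z (complex_poly g) \<le> order z (complex_poly f)"
      using f0 g_dvd by (intro dvd_imp_order_le) simp_all
    moreover have "order z (complex_poly g) \<noteq> 0"
      using z g0 by (simp add: order_root)
    ultimately show ?thesis using irr by simp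
  qed
  define A where "A = {x :: real. poly (complex_poly g) (of_real x) = 0}"
  have Z: "{z. poly (complex_poly g) z = 0} = of_real ` A"
    using root by (auto simp: A_def elim!: Reals_cases)
  have inj: "inj_on complex_of_real A" by (simp add: inj_on_def)
  have finA: "finite A"
    using poly_roots_finite[of "complex_poly g"] g0 inj unfolding Z by (auto dest: finite_imageD)
  \<comment> \<open>All roots are simple, so the plain set \<open>A\<close> records the full
    factorization of \<open>g\<close>.\<close>
  have "rsquarefree (complex_poly g)"
    using root g0 by (auto simp: rsquarefree_def order_root)
  hence dec: "complex_poly g = smult (of_rat (lead_coeff g)) (\<Prod>a\<in>A. [:- of_real a, 1:])"
    using complex_poly_decompose_rsquarefree[of "complex_poly g"] inj unfolding Z
    by (simp add: prod.reindex coeff_map_poly degree_map_poly)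
  have "degree (complex_poly g) = card A"
    using g0 by (subst dec) (simp add: degree_prod_eq_sum_degree)
  hence card: "card A = degree g" by (simp add: degree_map_poly)
  have eval: "of_rat (poly g x) = of_rat (lead_coeff g) * (\<Prod>a\<in>A. of_rat x - a)" for x
  proof -
    have "(of_rat (poly g x) :: complex) = poly (complex_poly g) (of_rat x)"
      by (simp add: poly_map_poly_of_rat)
    also have "\<dots> = of_rat (lead_coeff g) * (\<Prod>a\<in>A. of_rat x - of_real a)"
      by (subst dec) (simp add: poly_prod)
    finally have "complex_of_real (of_rat (poly g x))
        = of_real (of_rat (lead_coeff g) * (\<Prod>a\<in>A. of_rat x - a))"
      by (simp add: of_real_of_rat)
    thus ?thesis by (simp only: of_real_eq_iff)
  qed
  have irrA: "A \<inter> \<rat> = {}"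
    using root by (fastforce simp: A_def of_real_of_rat elim!: Rats_cases)
  have ex: "\<exists>F. degree F > 0 \<and> all_roots_rational F \<and> poly F \<rho> = 0 \<and> g dvd pderiv F" for \<rho>
    using exists_poly_prescribed_critical_points[OF g0 finA card irrA eval, of \<rho>] by metis
  \<comment> \<open>The divisibility of \<open>F\<close> itself strengthens the induction: it is
    needed for the summand of the product rule in which \<open>F\<close> is not
    differentiated.\<close>
  have "\<exists>F. degree F > 0 \<and> all_roots_rational F \<and> (\<Prod>\<rho>\<leftarrow>L. [:- \<rho>, 1:]) dvd F \<and>
      (\<Prod>\<rho>\<leftarrow>L. [:- \<rho>, 1:]) * g dvd pderiv F"
  proof (induction L)
    case Nil
    show ?case using ex[of 0] by auto
  next
    case (Cons \<rho> L)
    define H where "H = (\<Prod>\<rho>\<leftarrow>L. [:- \<rho>, 1:])"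
    obtain F where F: "degree F > 0" "all_roots_rational F" "H dvd F" "H * g dvd pderiv F"
      using Cons by (auto simp: H_def)
    obtain E where E: "degree E > 0" "all_roots_rational E" "[:- \<rho>, 1:] dvd E" "g dvd pderiv E"
      using ex[of \<rho>] by (auto simp: poly_eq_0_iff_dvd)
    \<comment> \<open>Squaring \<open>E\<close> leaves a factor \<open>E\<close>, hence
      \<open>x - \<rho>\<close>, in both summands. The factor \<open>H * g\<close> comes from
      \<open>F'\<close> in the first, and from \<open>F\<close> and \<open>E'\<close> in the
      second.\<close>
    have d: "pderiv (F * (E * E)) = pderiv F * (E * E) + E * (F * (2 * pderiv E))"
      by (simp add: pderiv_mult algebra_simps)
    have "[:- \<rho>, 1:] * (H * g) dvd pderiv (F * (E * E))"
      unfolding d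
    proof (rule dvd_add)
      show "[:- \<rho>, 1:] * (H * g) dvd pderiv F * (E * E)"
        using mult_dvd_mono[OF dvd_mult[OF E(3), of E] F(4)] by (simp only: mult_ac)
      show "[:- \<rho>, 1:] * (H * g) dvd E * (F * (2 * pderiv E))"
        by (intro mult_dvd_mono E F dvd_mult)
    qed
    moreover have "[:- \<rho>, 1:] * H dvd F * (E * E)"
      using mult_dvd_mono[OF dvd_mult[OF E(3), of E] F(3)] by (simp only: mult_ac)
    moreover have "degree (F * (E * E)) > 0"
      using F(1) E(1) by (subst degree_mult_eq) auto
    moreover have "all_roots_rational (F * (E * E))"
      using F E by (intro all_roots_rational_mult)
    ultimately show ?case
      by (intro exI[of _ "F * (E * E)"]) (simp add: H_def mult.assoc del: mult_pCons_left)
  qed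
  thus ?thesis unfolding fL by blast
qed

(* F is required to be nonconstant: with a nonzero constant F (no roots, zero derivative)
   the second condition would hold for every f. *)
theorem theorem2:
  fixes f :: "rat poly"
  shows "irrational_roots_real_simple f \<longleftrightarrow>
    (\<exists>F :: rat poly. degree F > 0 \<and> all_roots_rational F \<and> f dvd pderiv F)"
  using exists_poly_if_irrational_roots_real_simple irrational_roots_real_simple_if_dvd_pderiv
  by blast

end
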